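(* Let $m$ and $n$ be positive integers such that $n\geq 2m-2$. A permutation $\pi\in S_n$ lies in the image $s^{n-m}(S_n)$ of the $(n-m)$-fold iterate of West's stack-sorting map if and only if $\operatorname{tl}(\pi)\geq n-m$ and every descent top of $\pi$ is a left-to-right maximum of $\pi$. Consequently, $|s^{n-m}(S_n)|=B_m$, the $m$-th Bell number.
   Context: A permutation is an ordering of a finite set of positive integers, written in one-line notation; $S_n$ is the set of permutations of $[n]=\{1,\ldots,n\}$. West's stack-sorting map $s$ is defined recursively: $s$ sends the empty permutation to itself, and for a nonempty permutation $\pi=LmR$ with $m$ its largest entry, $s(\pi)=s(L)\,s(R)\,m$. $s^t$ denotes the $t$-fold iterate. For $\pi=\pi_1\cdots\pi_n$, a descent is an index $i$ with $\pi_i>\pi_{i+1}$, and $\pi_i$ is then a descent top. A left-to-right maximum is an entry $\pi_j$ with $\pi_j>\pi_\ell$ for all $\ell<j$. The tail length $\operatorname{tl}(\pi)$ of $\pi\in S_n$ is the largest $\ell\in\{0,\ldots,n\}$ such that $\pi_i=i$ for all $i\in\{n-\ell+1,\ldots,n\}$. The Bell number $B_m$ is the number of set partitions of $[m]$. *)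

theory Defs
  imports Main "HOL-Library.Disjoint_Sets" "HOL-Combinatorics.Multiset_Permutations"
begin

text \<open>Permutations are written in one-line notation as lists of distinct numbers, so that the
  entry \<open>\<pi>\<^sub>i\<close> is \<open>\<pi> ! (i - 1)\<close>.\<close>

definition Sym :: "nat \<Rightarrow> nat list set" where
  "Sym n = permutations_of_set {1..n}"

function stack_sort :: "nat list \<Rightarrow> nat list" where
  "stack_sort [] = []"
| "xs \<noteq> [] \<Longrightarrow> stack_sort xs =
     (let m = Max (set xs);
          L = takeWhile (\<lambda>x. x \<noteq> m) xs;
          R = tl (dropWhile (\<lambda>x. x \<noteq> m) xs)
      in stack_sort L @ stack_sort R @ [m])"
  by auto
termination
proof (relation "measure length", goal_cases)
  case 1
  show ?case by simp
next
  case (2 xs m L)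
  then have "m \<in> set xs" by simp
  then obtain ys zs where "xs = ys @ m # zs" "m \<notin> set ys"
    by (meson split_list_first)
  moreover from this have "takeWhile (\<lambda>x. x \<noteq> m) xs = ys"
    by (subst \<open>xs = ys @ m # zs\<close>, subst takeWhile_append2) auto
  ultimately show ?case unfolding 2(3) by simp
next
  case (3 xs m L R)
  have "length (dropWhile (\<lambda>x. x \<noteq> m) xs) \<le> length xs"
    by (rule length_dropWhile_le)
  moreover have "0 < length xs" using 3(1) by simp
  ultimately show ?case unfolding 3(4) by (simp del: length_greater_0_conv)
qed

lemma stack_sort_decomp:
  assumes "distinct (L @ m # R)" and "\<forall>x \<in> set L \<union> set R. x < m"
  shows "stack_sort (L @ m # R) = stack_sort L @ stack_sort R @ [m]"
proof -
  have "Max (set (L @ m # R)) = m"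
    using assms(2) by (intro Max_eqI) (auto intro: less_imp_le)
  moreover have "\<forall>x \<in> set L. x \<noteq> m" using assms(1) by auto
  then have "takeWhile (\<lambda>x. x \<noteq> m) (L @ m # R) = L"
    and "dropWhile (\<lambda>x. x \<noteq> m) (L @ m # R) = m # R"
    by (simp_all add: takeWhile_append2 dropWhile_append2)
  ultimately show ?thesis by (subst stack_sort.simps(2)) (simp_all add: Let_def)
qed

definition descents :: "nat list \<Rightarrow> nat set" where
  "descents \<pi> = {i. 1 \<le> i \<and> i < length \<pi> \<and> \<pi> ! (i - 1) > \<pi> ! i}"

definition descent_tops :: "nat list \<Rightarrow> nat set" where
  "descent_tops \<pi> = {\<pi> ! (i - 1) | i. i \<in> descents \<pi>}"

definition left_to_right_maxima :: "nat list \<Rightarrow> nat set" where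
  "left_to_right_maxima \<pi> =
     {\<pi> ! (j - 1) | j. j \<in> {1..length \<pi>} \<and> (\<forall>l \<in> {1..<j}. \<pi> ! (j - 1) > \<pi> ! (l - 1))}"

definition tail_length :: "nat list \<Rightarrow> nat" where
  "tail_length \<pi> = (let n = length \<pi> in
     Max {l \<in> {0..n}. \<forall>i \<in> {n - l + 1..n}. \<pi> ! (i - 1) = i})"

definition Bell :: "nat \<Rightarrow> nat" where
  "Bell m = card {P. partition_on {1..m} P}"

end

theory Submission
  imports Defs
begin

text \<open>
  For \<open>a < b\<close>, the entry \<open>b\<close> precedes \<open>a\<close> in \<open>s(\<sigma>)\<close> iff some \<open>c > b\<close> lies between \<open>b\<close> and \<open>a\<close> in
  \<open>\<sigma>\<close>.  Suppose \<open>b\<close> is a descent top of \<open>s\<^sup>t(\<sigma>)\<close>, with descent bottom \<open>a\<close>, that is not a left-to-right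
  maximum.  In each \<open>s\<^sup>i(\<sigma>)\<close> let \<open>F\<close> be the set of entries larger than \<open>b\<close> that precede \<open>b\<close>, and \<open>E\<close>
  the set of those between \<open>b\<close> and \<open>a\<close>.  Going backwards from \<open>i = t\<close>, where \<open>E\<close> is empty and \<open>F\<close> is
  not, the maximum of \<open>F\<close> always exceeds that of \<open>E\<close>; hence each application of \<open>s\<close> moves both maxima
  past \<open>a\<close>, so \<open>F \<union> E\<close> loses two elements per step and \<open>n \<ge> 2t + 3\<close>.

  Conversely, a permutation whose descent tops are left-to-right maxima has the form
  \<open>c\<^sub>1 A\<^sub>1 c\<^sub>2 A\<^sub>2 \<dots> c\<^sub>k A\<^sub>k\<close> with left-to-right maxima \<open>c\<^sub>i\<close> and increasing words \<open>A\<^sub>i\<close>.  If \<open>A\<^sub>k\<close> is empty,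
  then \<open>c\<^sub>1 c\<^sub>2 A\<^sub>1 \<dots> c\<^sub>k A\<^bsub>k-1\<^esub>\<close> is a preimage of the same form whose tail is at most one shorter, and
  this can be iterated.  The blocks \<open>{c\<^sub>i} \<union> A\<^sub>i\<close> form an arbitrary set partition.
\<close>

section \<open>Inversions under stack-sorting\<close>

fun before :: "'a list \<Rightarrow> 'a \<Rightarrow> 'a \<Rightarrow> bool" where
  "before [] x y \<longleftrightarrow> False"
| "before (z # zs) x y \<longleftrightarrow> z = x \<and> y \<in> set zs \<or> before zs x y"

lemma before_append [simp]:
  "before (xs @ ys) x y \<longleftrightarrow> before xs x y \<or> before ys x y \<or> x \<in> set xs \<and> y \<in> set ys"
  by (induction xs) auto

lemma before_in_set: "before xs x y \<Longrightarrow> x \<in> set xs \<and> y \<in> set xs"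
  by (induction xs) auto

lemma before_total:
  "x \<in> set xs \<Longrightarrow> y \<in> set xs \<Longrightarrow> x \<noteq> y \<Longrightarrow> before xs x y \<or> before xs y x"
  by (induction xs) auto

lemma before_asym: "distinct xs \<Longrightarrow> before xs x y \<Longrightarrow> \<not> before xs y x"
  by (induction xs) (auto dest: before_in_set)

lemma before_trans: "distinct xs \<Longrightarrow> before xs x y \<Longrightarrow> before xs y z \<Longrightarrow> before xs x z"
  by (induction xs) (auto dest: before_in_set)

text \<open>Follows the recursion of \<open>stack_sort\<close>: the word is split at its maximum, so
  \<open>stack_sort_decomp\<close> applies to exactly the words met in the induction step.\<close>

lemma distinct_max_induct [consumes 1, case_names Nil split]:
  fixes xs :: "'a :: linorder list"
  assumes "distinct xs"
    and "P []"
    and "\<And>L m R. distinct (L @ m # R) \<Longrightarrow> \<forall>x \<in> set L \<union> set R. x < m \<Longrightarrow> P L \<Longrightarrow> P R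
          \<Longrightarrow> P (L @ m # R)"
  shows "P xs"
  using assms(1)
proof (induction xs rule: length_induct)
  case (1 xs)
  show ?case
  proof (cases "xs = []")
    case True
    then show ?thesis using assms(2) by simp
  next
    case False
    then have "Max (set xs) \<in> set xs" by simp
    then obtain L R where xs: "xs = L @ Max (set xs) # R" by (meson split_list)
    let ?m = "Max (set xs)"
    have dist: "distinct (L @ ?m # R)" using 1(2) xs by metis
    have "x < ?m" if "x \<in> set L \<union> set R" for x
    proof -
      have "x \<in> set xs" using that by (subst xs) auto
      moreover have "x \<noteq> ?m" using that dist by auto
      ultimately show ?thesis by (simp add: order_less_le)
    qed
    moreover have "length xs = length L + Suc (length R)" by (subst xs) simp
    then have "P L" "P R" using 1(1) dist by auto
    ultimately have "P (L @ ?m # R)" using assms(3)[OF dist] by blast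
    then show ?thesis using xs by simp
  qed
qed

lemma set_stack_sort [simp]: "distinct xs \<Longrightarrow> set (stack_sort xs) = set xs"
proof (induction rule: distinct_max_induct)
  case (split L m R)
  then show ?case by (subst stack_sort_decomp) auto
qed simp

lemma distinct_stack_sort [simp]: "distinct xs \<Longrightarrow> distinct (stack_sort xs)"
proof (induction rule: distinct_max_induct)
  case (split L m R)
  then show ?case by (subst stack_sort_decomp) auto
qed simp

lemma stack_sort_snoc:
  "distinct (xs @ [x]) \<Longrightarrow> \<forall>y \<in> set xs. y < x \<Longrightarrow> stack_sort (xs @ [x]) = stack_sort xs @ [x]"
  by (subst stack_sort_decomp) auto

lemma stack_sort_sorted: "sorted_wrt (<) xs \<Longrightarrow> stack_sort xs = xs"
proof (induction xs rule: rev_induct)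
  case (snoc x xs)
  then show ?case
    by (subst stack_sort_snoc) (auto simp: sorted_wrt_append strict_sorted_iff)
qed simp

text \<open>If the maximum \<open>m\<close> separates \<open>b\<close> from \<open>a\<close>, then
  \<open>m\<close> is the required \<open>c\<close>, and \<open>s(L)\<close> is output before
  \<open>s(R)\<close>. If both lie on one side of \<open>m\<close>, so does every entry between
  them, and induction applies. The case \<open>b = m\<close> cannot occur on either side: no
  \<open>c\<close> exceeds \<open>m\<close>, and \<open>m\<close> is output last.\<close>

lemma before_stack_sort_iff:
  assumes "distinct xs" and "a < b"
  shows "before (stack_sort xs) b a \<longleftrightarrow> (\<exists>c > b. before xs b c \<and> before xs c a)"
  using assms
proof (induction rule: distinct_max_induct)
  case (split L m R)
  have d: "distinct L" "distinct R" "set L \<inter> set R = {}" "m \<notin> set L" "m \<notin> set R"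
    using split(1) by auto
  have lt: "\<And>x. x \<in> set L \<Longrightarrow> x < m" "\<And>x. x \<in> set R \<Longrightarrow> x < m" using split(2) by auto
  have eq: "before (stack_sort (L @ m # R)) b a \<longleftrightarrow>
      before (stack_sort L) b a \<or> before (stack_sort R) b a \<or> b \<in> set L \<and> a \<in> set R"
    using d lt \<open>a < b\<close> by (subst stack_sort_decomp[OF split(1,2)]) (auto dest: lt)
  have iff: "before (L @ m # R) x y \<longleftrightarrow>
      before L x y \<or> before R x y \<or> x \<in> set L \<and> y \<in> insert m (set R) \<or> x = m \<and> y \<in> set R" for x y
    by auto
  show ?case
  proof
    assume "before (stack_sort (L @ m # R)) b a"
    then consider "before (stack_sort L) b a" | "before (stack_sort R) b a" | "b \<in> set L" "a \<in> set R"
      using eq by blast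
    then show "\<exists>c > b. before (L @ m # R) b c \<and> before (L @ m # R) c a"
    proof cases
      case 3
      then show ?thesis using lt by (intro exI[of _ m]) auto
    qed (use split.IH[OF \<open>a < b\<close>] iff in blast)+
  next
    assume "\<exists>c > b. before (L @ m # R) b c \<and> before (L @ m # R) c a"
    then obtain c where c: "c > b" "before (L @ m # R) b c" "before (L @ m # R) c a" by blast
    have "b \<noteq> m" using c(1) before_in_set[OF c(2)] lt by fastforce
    then consider "b \<in> set L" | "b \<in> set R" using before_in_set[OF c(2)] by auto
    then show "before (stack_sort (L @ m # R)) b a"
    proof cases
      case 1
      have "a \<noteq> m" using \<open>a < b\<close> lt(1)[OF 1] by auto
      then consider "a \<in> set R" | "a \<in> set L" using before_in_set[OF c(3)] by auto
      then show ?thesis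
      proof cases
        case 2
        then have "a \<notin> set R" "b \<notin> set R" using 1 d(3) by auto
        then have ca: "before L c a" using c(3) \<open>a \<noteq> m\<close> by (auto dest: before_in_set)
        then have "c \<notin> set R" "c \<noteq> m" using before_in_set[OF ca] d by auto
        then have "before L b c" using c(2) by (auto dest: before_in_set)
        then show ?thesis using ca c(1) eq split.IH(1)[OF \<open>a < b\<close>] by blast
      qed (use 1 eq in simp)
    next
      case 2
      then have "b \<notin> set L" using d(3) by auto
      then have bc: "before R b c" using c(2) \<open>b \<noteq> m\<close> by (auto dest: before_in_set)
      then have "c \<notin> set L" "c \<noteq> m" using before_in_set[OF bc] d by auto
      then have "before R c a" using c(3) by (auto dest: before_in_set)
      then show ?thesis using bc c(1) eq split.IH(2)[OF \<open>a < b\<close>] by blast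
    qed
  qed
qed simp

section \<open>Descent tops of highly sorted permutations\<close>

text \<open>With \<open>F\<close> and \<open>E\<close> as above, this says \<open>max F > max E\<close> and \<open>|F \<union> E| \<ge> k\<close>.\<close>

definition descent_gap :: "nat list \<Rightarrow> nat \<Rightarrow> nat \<Rightarrow> nat \<Rightarrow> bool" where
  "descent_gap xs a b k \<longleftrightarrow> before xs b a
     \<and> (\<exists>M > b. before xs M b \<and> (\<forall>e > b. before xs b e \<and> before xs e a \<longrightarrow> e < M))
     \<and> k \<le> card {x. b < x \<and> before xs x a}"

text \<open>The two additional entries are the maxima \<open>N\<close> of \<open>F\<close> and
  \<open>e\<close> of \<open>E\<close>, taken in \<open>xs\<close>: both precede \<open>a\<close>
  there, and neither does after sorting. The entry \<open>N\<close> is also the new witness for the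
  bound on \<open>E\<close>.\<close>

lemma descent_gap_stack_sort:
  assumes dist: "distinct xs" and "a < b" and gap: "descent_gap (stack_sort xs) a b k"
  shows "descent_gap xs a b (k + 2)"
proof -
  let ?ys = "stack_sort xs"
  note inv = before_stack_sort_iff[OF dist]
  \<comment> \<open>Sorting creates no inversions, so larger entries preceding \<open>a\<close> or
    \<open>b\<close> in \<open>?ys\<close> already did so in \<open>xs\<close>.\<close>
  have inv_back: "before xs y x" if "before ?ys y x" "x < y" for x y
    using that inv before_trans[OF dist] by blast
  have dist': "distinct ?ys" using dist by simp
  obtain M where M: "M > b" "before ?ys M b" "\<And>e. e > b \<Longrightarrow> before ?ys b e \<Longrightarrow> before ?ys e a \<Longrightarrow> e < M"
    using gap unfolding descent_gap_def by blast
  have ba: "before ?ys b a" using gap unfolding descent_gap_def by blast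
  have ba': "before xs b a" using inv_back ba \<open>a < b\<close> by blast
  define F where "F = {x. b < x \<and> before xs x b}"
  define E where "E = {x. b < x \<and> before xs b x \<and> before xs x a}"
  have fin: "finite F" "finite E"
    by (rule finite_subset[of _ "set xs"], auto simp: F_def E_def dest: before_in_set)+
  have "M \<in> F" using M inv_back by (auto simp: F_def)
  define N where "N = Max F"
  have N: "N \<in> F" "\<And>x. x \<in> F \<Longrightarrow> x \<le> N"
    unfolding N_def using Max_in[OF fin(1)] Max_ge[OF fin(1)] \<open>M \<in> F\<close> by blast+
  have Nb: "b < N" "before xs N b" using N by (auto simp: F_def)
  \<comment> \<open>To stay in front of \<open>b\<close>, \<open>N\<close> would need a larger entry
    between itself and \<open>b\<close> in \<open>xs\<close>; that entry would lie in
    \<open>F\<close>.\<close>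
  have "\<not> before ?ys N b"
  proof
    assume "before ?ys N b"
    then obtain c where "c > N" "before xs c b" using inv Nb by blast
    then show False using N(2)[of c] Nb by (auto simp: F_def)
  qed
  then have "before ?ys b N" and "M \<noteq> N"
    using before_total[of N ?ys b] Nb before_in_set[OF Nb(2)] dist M by auto
  then have "M < N" using N(2)[OF \<open>M \<in> F\<close>] by simp
  \<comment> \<open>Otherwise \<open>N\<close> would lie between \<open>b\<close> and
    \<open>a\<close> in \<open>?ys\<close>, and the gap hypothesis would force
    \<open>N < M\<close>.\<close>
  have Na: "\<not> before ?ys N a" using M(3)[OF Nb(1) \<open>before ?ys b N\<close>] \<open>M < N\<close> by auto
  \<comment> \<open>An element of \<open>E\<close> above \<open>N\<close> would lie between
    \<open>N\<close> and \<open>a\<close> in \<open>xs\<close> and so keep \<open>N\<close> in front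
    of \<open>a\<close> after sorting.\<close>
  have EN: "e < N" if "e \<in> E" for e
  proof (rule ccontr)
    assume "\<not> e < N"
    moreover have "e \<noteq> N" using that Nb before_asym[OF dist] by (auto simp: E_def)
    ultimately have "N < e" by simp
    moreover have "before xs N e" using that Nb before_trans[OF dist] by (auto simp: E_def)
    ultimately show False
      using Na that inv[of a N] \<open>a < b\<close> Nb by (auto simp: E_def)
  qed
  have "E \<noteq> {}" using ba inv[OF \<open>a < b\<close>] by (auto simp: E_def)
  define e where "e = Max E"
  have e: "e \<in> E" "\<And>x. x \<in> E \<Longrightarrow> x \<le> e" using fin \<open>E \<noteq> {}\<close> unfolding e_def by auto
  have ea: "\<not> before ?ys e a"
  proof
    assume "before ?ys e a"
    then obtain c where c: "c > e" "before xs e c" "before xs c a"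
      using inv[of a e] e \<open>a < b\<close> by (auto simp: E_def)
    then have "c \<in> E" using e(1) before_trans[OF dist] by (auto simp: E_def)
    then show False using e(2)[of c] c(1) by simp
  qed
  let ?G = "{x. b < x \<and> before ?ys x a}" and ?H = "{x. b < x \<and> before xs x a}"
  have finH: "finite ?H"
    by (rule finite_subset[of _ "set xs"]) (auto dest: before_in_set)
  have sub: "insert N (insert e ?G) \<subseteq> ?H"
    using Nb e(1) ba' before_trans[OF dist] inv_back \<open>a < b\<close> by (auto simp: E_def)
  then have "finite ?G" using finite_subset[OF _ finH] by (meson insert_subset)
  then have "card (insert N (insert e ?G)) = card ?G + 2" using Na ea EN[OF e(1)] by simp
  then have "card ?G + 2 \<le> card ?H" using card_mono[OF finH sub] by simp
  then show ?thesis
    using gap ba' Nb EN unfolding descent_gap_def E_def by (auto intro!: exI[of _ N])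
qed

lemma distinct_funpow_stack_sort: "distinct xs \<Longrightarrow> distinct ((stack_sort ^^ t) xs)"
  by (induction t) auto

lemma set_funpow_stack_sort: "distinct xs \<Longrightarrow> set ((stack_sort ^^ t) xs) = set xs"
  by (induction t) (auto simp: distinct_funpow_stack_sort)

lemma descent_gap_funpow:
  assumes "distinct xs" and "a < b" and "descent_gap ((stack_sort ^^ t) xs) a b k"
  shows "descent_gap xs a b (k + 2 * t)"
  using assms
proof (induction t arbitrary: k)
  case (Suc t)
  then show ?case
    using descent_gap_stack_sort[of "(stack_sort ^^ t) xs" a b k] Suc.IH[of "k + 2"]
    by (simp add: distinct_funpow_stack_sort)
qed simp

text \<open>For distinct entries this says, without indices, that descent tops are left-to-right maxima.\<close>

definition tops_ok :: "nat list \<Rightarrow> bool" where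
  "tops_ok xs \<longleftrightarrow> (\<forall>L b a R. xs = L @ b # a # R \<longrightarrow> a < b \<longrightarrow> (\<forall>x \<in> set L. x < b))"

text \<open>Start of the backward count: as \<open>b\<close> and \<open>a\<close> are adjacent,
  \<open>E\<close> is empty, so the larger entry \<open>c\<close> in front of \<open>b\<close>
  serves as \<open>M\<close> and is itself the one entry counted.\<close>

lemma descent_gap_of_bad_top:
  assumes "distinct (L @ b # a # R)" and "a < b" and "c \<in> set L" and "b < c"
  shows "descent_gap (L @ b # a # R) a b 1"
proof -
  have "finite {x. b < x \<and> before (L @ b # a # R) x a}"
    by (rule finite_subset[of _ "set (L @ b # a # R)"]) (use before_in_set in fast, simp)
  moreover have "c \<in> {x. b < x \<and> before (L @ b # a # R) x a}" using assms by simp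
  ultimately have "1 \<le> card {x. b < x \<and> before (L @ b # a # R) x a}"
    by (metis One_nat_def Suc_leI card_gt_0_iff empty_iff)
  then show ?thesis
    unfolding descent_gap_def using assms
    by (auto intro!: exI[of _ c] dest: before_in_set)
qed

lemma tops_ok_funpow_stack_sort:
  assumes dist: "distinct xs" and len: "length xs \<le> 2 * t + 2"
  shows "tops_ok ((stack_sort ^^ t) xs)"
  unfolding tops_ok_def
proof (intro allI impI ballI, rule ccontr)
  fix L b a R x
  assume eq: "(stack_sort ^^ t) xs = L @ b # a # R" and "a < b" "x \<in> set L" "\<not> x < b"
  have d: "distinct (L @ b # a # R)" using distinct_funpow_stack_sort[OF dist, of t] eq by simp
  have "b < x" using d \<open>x \<in> set L\<close> \<open>\<not> x < b\<close> by (auto simp: not_less order_le_less)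
  then have "descent_gap ((stack_sort ^^ t) xs) a b 1"
    using descent_gap_of_bad_top[OF d \<open>a < b\<close> \<open>x \<in> set L\<close>] eq by simp
  from descent_gap_funpow[OF dist \<open>a < b\<close> this]
  have card: "1 + 2 * t \<le> card {x. b < x \<and> before xs x a}" and ba: "before xs b a"
    unfolding descent_gap_def by auto
  have ab: "{a, b} \<subseteq> set xs" using before_in_set[OF ba] by simp
  \<comment> \<open>The counted entries exceed \<open>b\<close>, so \<open>a\<close> and
    \<open>b\<close> come on top of the \<open>1 + 2 * t\<close>. This makes
    \<open>2 * t + 3\<close> entries, one more than the length allows.\<close>
  have "{x. b < x \<and> before xs x a} \<subseteq> set xs - {a, b}"
    using \<open>a < b\<close> by (auto dest: before_in_set)
  then have "card {x. b < x \<and> before xs x a} \<le> card (set xs - {a, b})"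
    by (intro card_mono) auto
  also have "\<dots> = card (set xs) - card {a, b}" using ab by (intro card_Diff_subset) auto
  also have "\<dots> = length xs - 2" using \<open>a < b\<close> dist by (simp add: distinct_card)
  finally show False using card len by simp
qed

section \<open>Block decomposition at the left-to-right maxima\<close>

text \<open>A pair \<open>(c, A)\<close> encodes a left-to-right maximum \<open>c\<close> with the
  word \<open>A\<close> that follows it up to the next one.\<close>

definition flat :: "(nat \<times> nat list) list \<Rightarrow> nat list" where
  "flat bs = concat (map (\<lambda>(c, A). c # A) bs)"

text \<open>Heads are written last because this is the effect of \<open>stack_sort\<close> on
  \<open>flat bs\<close>.\<close>

definition coflat :: "(nat \<times> nat list) list \<Rightarrow> nat list" where
  "coflat bs = concat (map (\<lambda>(c, A). A @ [c]) bs)"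

definition block_list :: "(nat \<times> nat list) list \<Rightarrow> bool" where
  "block_list bs \<longleftrightarrow> sorted_wrt (<) (map fst bs)
     \<and> (\<forall>(c, A) \<in> set bs. sorted_wrt (<) A \<and> (\<forall>a \<in> set A. a < c))"

lemma flat_simps [simp]:
  "flat [] = []" "flat ((c, A) # bs) = c # A @ flat bs" "flat (bs @ bs') = flat bs @ flat bs'"
  by (simp_all add: flat_def)

lemma coflat_simps [simp]:
  "coflat [] = []" "coflat ((c, A) # bs) = A @ c # coflat bs"
  "coflat (bs @ bs') = coflat bs @ coflat bs'"
  by (simp_all add: coflat_def)

lemma flat_singletons [simp]: "flat (map (\<lambda>c. (c, [])) T) = T"
  by (induction T) auto

lemma coflat_singletons [simp]: "coflat (map (\<lambda>c. (c, [])) T) = T"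
  by (induction T) auto

lemma mset_coflat: "mset (coflat bs) = mset (flat bs)"
  by (induction bs) auto

lemma set_flat: "set (flat bs) = (\<Union>(c, A) \<in> set bs. insert c (set A))"
  by (induction bs) auto

lemma block_list_Nil [simp]: "block_list []"
  by (simp add: block_list_def)

lemma block_list_Cons:
  "block_list ((c, A) # bs) \<longleftrightarrow> (\<forall>x \<in> set bs. c < fst x) \<and> sorted_wrt (<) A \<and> (\<forall>a \<in> set A. a < c)
     \<and> block_list bs"
  by (auto simp: block_list_def)

lemma block_list_append:
  "block_list (bs @ bs') \<longleftrightarrow>
     block_list bs \<and> block_list bs' \<and> (\<forall>x \<in> set bs. \<forall>y \<in> set bs'. fst x < fst y)"
  by (simp add: block_list_def sorted_wrt_append ball_Un) blast

lemma block_list_singletons: "sorted_wrt (<) T \<Longrightarrow> block_list (map (\<lambda>c. (c, [])) T)"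
  by (induction T) (auto simp: block_list_Cons)

lemma flat_less_last:
  assumes "block_list (bs @ [(c, A)])" and "x \<in> set (flat bs)"
  shows "x < c"
proof -
  obtain d B where d: "(d, B) \<in> set bs" "x \<in> insert d (set B)" using assms(2) by (auto simp: set_flat)
  then have "x \<le> d" using assms(1) by (fastforce simp: block_list_def)
  moreover have "d < c" using assms(1) d(1) by (auto simp: block_list_append)
  ultimately show ?thesis by simp
qed

text \<open>The last head is the maximum of the whole word. Splitting there leaves the earlier
  blocks on the left, handled by induction, and an increasing word on the right, which sorting
  fixes.\<close>

lemma stack_sort_flat:
  assumes "block_list bs" and "distinct (flat bs)"
  shows "stack_sort (flat bs) = coflat bs"
  using assms
proof (induction bs rule: rev_induct)
  case (snoc b bs)
  obtain c A where b: "b = (c, A)" by force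
  have bl: "block_list bs" "sorted_wrt (<) A" "\<forall>a \<in> set A. a < c"
    using snoc.prems(1) by (auto simp: b block_list_append block_list_Cons)
  have "stack_sort (flat bs @ c # A) = stack_sort (flat bs) @ stack_sort A @ [c]"
    using snoc.prems flat_less_last[of bs c A] bl by (intro stack_sort_decomp) (auto simp: b)
  then show ?case using snoc bl by (simp add: b stack_sort_sorted)
qed simp

text \<open>Every head receives the tail of the preceding block, the first one receives
  \<open>A\<close>, and the last tail is dropped. With \<open>A = []\<close> and an empty last tail
  this is the preimage construction.\<close>

fun shift_blocks :: "nat list \<Rightarrow> (nat \<times> nat list) list \<Rightarrow> (nat \<times> nat list) list" where
  "shift_blocks A [] = []"
| "shift_blocks A ((c, B) # bs) = (c, A) # shift_blocks B bs"

lemma fst_shift_blocks: "fst ` set (shift_blocks A bs) = fst ` set bs"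
  by (induction A bs rule: shift_blocks.induct) auto

lemma block_list_shift_blocks:
  assumes "block_list bs" and "sorted_wrt (<) A" and "\<forall>x \<in> set bs. \<forall>a \<in> set A. a < fst x"
  shows "block_list (shift_blocks A bs)"
  using assms
proof (induction A bs rule: shift_blocks.induct)
  case (2 A c B bs)
  have "\<forall>x \<in> fst ` set (shift_blocks B bs). c < x"
    using 2(2) by (auto simp: fst_shift_blocks block_list_Cons)
  moreover have "block_list (shift_blocks B bs)"
    \<comment> \<open>The tail \<open>B\<close> lies below its old head \<open>c\<close>, hence
      below all later heads.\<close>
    using 2(2) by (intro "2.IH") (auto simp: block_list_Cons, fastforce)
  ultimately show ?case using 2 by (auto simp: block_list_Cons)
qed simp

text \<open>Writing heads last undoes the shift; the empty last tail ensures that no entry is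
  lost.\<close>

lemma coflat_shift_blocks:
  "coflat (shift_blocks A (bs @ [(c, [])])) = A @ flat (bs @ [(c, [])])"
  by (induction A bs rule: shift_blocks.induct) auto

text \<open>Each preimage step uses up one letter of the tail \<open>T\<close>: its first letter
  \<open>c\<close> becomes an empty last block, which allows a shift. The remaining letters stay
  behind as singleton blocks, which \<open>flat\<close> and \<open>coflat\<close> write
  alike.\<close>

lemma flat_in_funpow_stack_sort_image:
  assumes "block_list (bs @ map (\<lambda>c. (c, [])) T)" and "distinct (flat bs @ T)"
  shows "\<exists>xs. mset xs = mset (flat bs @ T) \<and> (stack_sort ^^ length T) xs = flat bs @ T"
  using assms
proof (induction T arbitrary: bs)
  case Nil
  then show ?case by (intro exI[of _ "flat bs"]) auto
next
  case (Cons c T)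
  let ?bs = "bs @ [(c, [])]" and ?T = "map (\<lambda>c. (c, [] :: nat list)) T"
  \<comment> \<open>Only the blocks up to \<open>c\<close> are shifted, so that \<open>?T\<close>
    remains available for the remaining steps.\<close>
  let ?bs' = "shift_blocks [] ?bs"
  have bl: "block_list (?bs @ ?T)" using Cons.prems(1) by simp
  have "\<forall>x \<in> fst ` set ?bs. \<forall>y \<in> set ?T. x < fst y"
    using bl unfolding block_list_append[of ?bs] by blast
  then have "\<forall>x \<in> fst ` set ?bs'. \<forall>y \<in> set ?T. x < fst y" by (simp only: fst_shift_blocks)
  moreover have "block_list ?bs'"
    using bl unfolding block_list_append[of ?bs] by (intro block_list_shift_blocks) auto
  ultimately have bl': "block_list (?bs' @ ?T)"
    using bl unfolding block_list_append[of ?bs] block_list_append[of ?bs'] by blast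
  have coflat: "coflat (?bs' @ ?T) = flat bs @ c # T"
    using coflat_shift_blocks[of "[]" bs c] by simp
  have ms: "mset (flat ?bs' @ T) = mset (flat bs @ c # T)"
    using mset_coflat[of "?bs' @ ?T"] coflat by simp
  then have dist: "distinct (flat ?bs' @ T)"
    using Cons.prems(2) mset_eq_imp_distinct_iff by blast
  from Cons.IH[OF bl' dist] obtain xs where
    xs: "mset xs = mset (flat ?bs' @ T)" "(stack_sort ^^ length T) xs = flat ?bs' @ T" by blast
  have "stack_sort (flat ?bs' @ T) = flat bs @ c # T"
    using stack_sort_flat[OF bl'] dist coflat by simp
  then show ?case using xs ms by (intro exI[of _ xs]) simp
qed

section \<open>Equivalence of the descent-top condition with a block decomposition\<close>

lemma tops_ok_snoc:
  "tops_ok (xs @ [x]) \<longleftrightarrow>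
     tops_ok xs \<and> (xs \<noteq> [] \<longrightarrow> x < last xs \<longrightarrow> (\<forall>y \<in> set (butlast xs). y < last xs))"
  (is "?l \<longleftrightarrow> ?r")
proof
  assume l: ?l
  have "tops_ok xs"
    unfolding tops_ok_def
  proof (intro allI impI)
    fix L b a R
    assume "xs = L @ b # a # R" "a < b"
    then show "\<forall>x \<in> set L. x < b"
      using l[unfolded tops_ok_def, rule_format, of L b a "R @ [x]"] by simp
  qed
  moreover have "\<forall>y \<in> set (butlast xs). y < last xs" if "xs \<noteq> []" "x < last xs"
    using l[unfolded tops_ok_def, rule_format, of "butlast xs" "last xs" x "[]"] that by simp
  ultimately show ?r by blast
next
  assume r: ?r
  show ?l
    unfolding tops_ok_def
  proof (intro allI impI)
    fix L b a R
    assume eq: "xs @ [x] = L @ b # a # R" and "a < b"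
    show "\<forall>x \<in> set L. x < b"
    proof (cases R rule: rev_cases)
      case Nil
      then have "(L @ [b]) @ [a] = xs @ [x]" using eq by simp
      then have "xs = L @ [b]" "x = a" by blast+
      then show ?thesis using r \<open>a < b\<close> by simp
    next
      case (snoc R' z)
      then have "(L @ b # a # R') @ [z] = xs @ [x]" using eq by simp
      then have "xs = L @ b # a # R'" by blast
      then show ?thesis using r \<open>a < b\<close> unfolding tops_ok_def by blast
    qed
  qed
qed

lemma tops_ok_Nil [simp]: "tops_ok []"
  by (simp add: tops_ok_def)

text \<open>The only descent that can arise is from \<open>c\<close> to the first letter of
  \<open>A\<close>, and \<open>c\<close> exceeds all that precedes it.\<close>

lemma tops_ok_append_block:
  assumes "tops_ok xs" and "\<forall>x \<in> set xs. x < c" and "sorted_wrt (<) A"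
  shows "tops_ok (xs @ c # A)"
  using assms(3)
proof (induction A rule: rev_induct)
  case Nil
  have "\<not> c < last xs" if "xs \<noteq> []" using assms(2) last_in_set[OF that] by (simp add: not_less less_imp_le)
  then show ?case using assms(1) by (simp add: tops_ok_snoc)
next
  case (snoc x A)
  then have "\<not> x < last A" if "A \<noteq> []"
    using last_in_set[OF that] by (simp add: sorted_wrt_append not_less less_imp_le)
  then have "tops_ok ((xs @ c # A) @ [x])"
    using snoc assms(2) by (subst tops_ok_snoc) (auto simp: sorted_wrt_append butlast_append)
  then show ?case by simp
qed

lemma tops_ok_flat: "block_list bs \<Longrightarrow> tops_ok (flat bs)"
proof (induction bs rule: rev_induct)
  case (snoc b bs)
  obtain c A where b: "b = (c, A)" by force
  have "block_list bs" "sorted_wrt (<) A"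
    using snoc.prems by (auto simp: b block_list_append block_list_Cons)
  then show ?case
    using snoc flat_less_last[of bs c A] tops_ok_append_block[of "flat bs" c A] by (auto simp: b)
qed simp

text \<open>The word is read from the left: a letter above the current head \<open>c\<close> opens a
  new block, and any other letter extends the current tail.\<close>

lemma tops_ok_imp_flat:
  assumes "tops_ok xs" and "distinct xs"
  shows "\<exists>bs. block_list bs \<and> flat bs = xs"
  using assms
proof (induction xs rule: rev_induct)
  case (snoc x xs)
  then obtain bs where bs: "block_list bs" "flat bs = xs" by (auto simp: tops_ok_snoc)
  show ?case
  proof (cases bs rule: rev_cases)
    case Nil
    then show ?thesis using bs by (intro exI[of _ "[(x, [])]"]) (auto simp: block_list_Cons)
  next
    case (snoc bs' b)
    obtain c A where b: "b = (c, A)" by force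
    have xs: "xs = flat bs' @ c # A" using bs snoc b by simp
    have bl: "block_list bs'" "\<forall>y \<in> set bs'. fst y < c" "sorted_wrt (<) A" "\<forall>a \<in> set A. a < c"
      using bs(1) by (auto simp: snoc b block_list_append block_list_Cons)
    have "x \<noteq> c" using \<open>distinct (xs @ [x])\<close> xs by auto
    then consider "c < x" | "x < c" by linarith
    then show ?thesis
    proof cases
      case 1
      then have "block_list (bs @ [(x, [])])"
        using bl by (auto simp: snoc b block_list_append block_list_Cons)
      then show ?thesis using bs by (intro exI[of _ "bs @ [(x, [])]"]) auto
    next
      case 2
      \<comment> \<open>If \<open>x\<close> were below \<open>last A\<close>, then
        \<open>last A\<close> would be a descent top preceded by the larger entry
        \<open>c\<close>.\<close>
      have "a < x" if "a \<in> set A" for a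
      proof -
        have "A \<noteq> []" using that by auto
        then have "last A \<in> set A" "c \<in> set (butlast xs)" "last xs = last A" "xs \<noteq> []"
          by (auto simp: xs butlast_append)
        then have "\<not> x < last A"
          using \<open>tops_ok (xs @ [x])\<close> bl(4) unfolding tops_ok_snoc by (metis less_asym)
        moreover have "x \<noteq> last A"
          using \<open>last A \<in> set A\<close> \<open>distinct (xs @ [x])\<close> by (auto simp: xs)
        moreover have "a \<le> last A"
          using that bl(3) by (cases A rule: rev_cases) (auto simp: sorted_wrt_append)
        ultimately show ?thesis by simp
      qed
      then have "block_list (bs' @ [(c, A @ [x])])"
        using bl 2 by (auto simp: block_list_append block_list_Cons sorted_wrt_append)
      then show ?thesis using xs by (intro exI[of _ "bs' @ [(c, A @ [x])]"]) auto
    qed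
  qed
qed (auto intro: exI[of _ "[]"])

lemma descent_tops_subset_iff:
  assumes "distinct p"
  shows "descent_tops p \<subseteq> left_to_right_maxima p \<longleftrightarrow> tops_ok p"
proof
  assume sub: "descent_tops p \<subseteq> left_to_right_maxima p"
  show "tops_ok p"
    unfolding tops_ok_def
  proof (intro allI impI ballI)
    fix L b a R x
    assume p: "p = L @ b # a # R" and "a < b" and "x \<in> set L"
    \<comment> \<open>Descents are indexed from 1, so the list position \<open>length L\<close> of
      \<open>b\<close> is shifted by one.\<close>
    have "Suc (length L) \<in> descents p" using \<open>a < b\<close> by (auto simp: p descents_def nth_append)
    then have "p ! length L \<in> descent_tops p" unfolding descent_tops_def by force
    then have "p ! length L \<in> left_to_right_maxima p" using sub by blast
    then obtain j where j: "p ! length L = p ! (j - 1)" "1 \<le> j" "j \<le> length p"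
        "\<forall>l \<in> {1..<j}. p ! (l - 1) < p ! (j - 1)"
      unfolding left_to_right_maxima_def by auto
    \<comment> \<open>Left-to-right maxima are recorded as values; distinctness of \<open>p\<close>
      identifies the position \<open>j\<close> with that of \<open>b\<close>.\<close>
    then have "length L = j - 1"
      using nth_eq_iff_index_eq[OF assms, of "length L" "j - 1"] by (simp add: p)
    moreover obtain k where k: "k < length L" "x = L ! k"
      using \<open>x \<in> set L\<close> by (metis in_set_conv_nth)
    ultimately have "p ! k < p ! length L" using j(2,4) by (auto dest!: bspec[of _ _ "Suc k"])
    then show "x < b" using k by (simp add: p nth_append)
  qed
next
  assume ok: "tops_ok p"
  show "descent_tops p \<subseteq> left_to_right_maxima p"
  proof
    fix b
    assume "b \<in> descent_tops p"
    then obtain i where i: "1 \<le> i" "i < length p" "p ! i < p ! (i - 1)" "b = p ! (i - 1)"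
      unfolding descent_tops_def descents_def by auto
    have "drop (i - 1) p = p ! (i - 1) # drop i p"
      using i Cons_nth_drop_Suc[of "i - 1" p] by simp
    moreover have "drop i p = p ! i # drop (Suc i) p" using i Cons_nth_drop_Suc[of i p] by simp
    ultimately have "p = take (i - 1) p @ p ! (i - 1) # p ! i # drop (Suc i) p"
      by (metis append_take_drop_id)
    then have less: "\<forall>x \<in> set (take (i - 1) p). x < p ! (i - 1)"
      using ok i(3) unfolding tops_ok_def by blast
    have "p ! (l - 1) < p ! (i - 1)" if "l \<in> {1..<i}" for l
    proof -
      have "p ! (l - 1) = take (i - 1) p ! (l - 1)" using that by auto
      also have "\<dots> \<in> set (take (i - 1) p)" using that i by (intro nth_mem) auto
      finally show ?thesis using less by blast
    qed
    then show "b \<in> left_to_right_maxima p"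
      unfolding left_to_right_maxima_def using i by force
  qed
qed

section \<open>Tails\<close>

text \<open>The admissible lengths are closed downwards, so the maximum reaches \<open>t\<close>
  exactly when \<open>t\<close> itself is admissible.\<close>

lemma tail_length_ge_iff:
  assumes "t \<le> length p"
  shows "t \<le> tail_length p \<longleftrightarrow> drop (length p - t) p = [Suc (length p - t)..<Suc (length p)]"
proof -
  let ?n = "length p"
  let ?S = "{l \<in> {0..?n}. \<forall>i \<in> {?n - l + 1..?n}. p ! (i - 1) = i}"
  have "finite ?S" by simp
  moreover have "0 \<in> ?S" by simp
  ultimately have "t \<le> tail_length p \<longleftrightarrow> (\<exists>l \<in> ?S. t \<le> l)"
    unfolding tail_length_def Let_def by (subst Max_ge_iff) blast+
  also have "\<dots> \<longleftrightarrow> (\<forall>i \<in> {?n - t + 1..?n}. p ! (i - 1) = i)"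
    using assms by (fastforce intro: bexI[of _ t])
  also have "\<dots> \<longleftrightarrow> (\<forall>k < t. p ! (?n - t + k) = Suc (?n - t + k))"
  proof
    assume *: "\<forall>i \<in> {?n - t + 1..?n}. p ! (i - 1) = i"
    show "\<forall>k < t. p ! (?n - t + k) = Suc (?n - t + k)"
    proof (intro allI impI)
      fix k
      assume "k < t"
      then have "Suc (?n - t + k) \<in> {?n - t + 1..?n}" using assms by auto
      then show "p ! (?n - t + k) = Suc (?n - t + k)" using * by fastforce
    qed
  next
    assume *: "\<forall>k < t. p ! (?n - t + k) = Suc (?n - t + k)"
    show "\<forall>i \<in> {?n - t + 1..?n}. p ! (i - 1) = i"
    proof
      fix i
      assume "i \<in> {?n - t + 1..?n}"
      then show "p ! (i - 1) = i" using *[rule_format, of "i - 1 - (?n - t)"] assms by auto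
    qed
  qed
  also have "\<dots> \<longleftrightarrow> drop (?n - t) p = [Suc (?n - t)..<Suc ?n]"
    using assms by (auto simp: list_eq_iff_nth_eq simp del: upt_Suc)
  finally show ?thesis .
qed

lemma stack_sort_append_sorted:
  assumes "distinct xs" and "sorted_wrt (<) zs" and "\<forall>x \<in> set xs. \<forall>z \<in> set zs. x < z"
  shows "stack_sort (xs @ zs) = stack_sort xs @ zs"
  using assms(2,3)
proof (induction zs rule: rev_induct)
  case (snoc z zs)
  have "stack_sort ((xs @ zs) @ [z]) = stack_sort (xs @ zs) @ [z]"
    using snoc.prems assms(1)
    by (intro stack_sort_snoc) (fastforce simp: sorted_wrt_append strict_sorted_iff)+
  then show ?case using snoc by (simp add: sorted_wrt_append)
qed simp

text \<open>Each application moves the largest entry of the unsorted prefix to the end of that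
  prefix, just in front of the tail already in place.\<close>

lemma funpow_stack_sort_tail:
  assumes "distinct xs" and "set xs = {1..n}" and "t \<le> n"
  shows "\<exists>ys. (stack_sort ^^ t) xs = ys @ [Suc (n - t)..<Suc n] \<and> distinct ys \<and> set ys = {1..n - t}"
  using assms(3)
proof (induction t)
  case 0
  then show ?case using assms by simp
next
  case (Suc t)
  let ?k = "n - t"
  obtain ys where ys: "(stack_sort ^^ t) xs = ys @ [Suc ?k..<Suc n]" "distinct ys" "set ys = {1..?k}"
    using Suc by auto
  have "?k \<in> set ys" using Suc.prems ys by simp
  then obtain L R where LR: "ys = L @ ?k # R" by (meson split_list)
  have "\<forall>x \<in> set L \<union> set R. x < ?k"
  proof
    fix x
    assume x: "x \<in> set L \<union> set R"
    then have "x \<in> set ys" "x \<noteq> ?k" using ys(2) LR by auto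
    then show "x < ?k" using ys(3) by auto
  qed
  then have "stack_sort ys = (stack_sort L @ stack_sort R) @ [?k]"
    using stack_sort_decomp[of L ?k R] ys(2) LR by simp
  moreover have "stack_sort (ys @ [Suc ?k..<Suc n]) = stack_sort ys @ [Suc ?k..<Suc n]"
    using ys by (intro stack_sort_append_sorted) (auto simp del: upt_Suc)
  moreover have "[Suc (n - Suc t)..<Suc n] = ?k # [Suc ?k..<Suc n]"
    using Suc.prems by (simp add: Suc_diff_Suc upt_conv_Cons del: upt_Suc)
  ultimately have "(stack_sort ^^ Suc t) xs = (stack_sort L @ stack_sort R) @ [Suc (n - Suc t)..<Suc n]"
    using ys(1) by simp
  moreover have "distinct (stack_sort L @ stack_sort R)" using ys(2) LR by simp
  moreover have "set (stack_sort L @ stack_sort R) = set ys - {?k}" using ys(2) LR by auto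
  moreover have "{1..?k} - {?k} = {1..n - Suc t}" by (rule set_eqI) (simp, linarith)
  ultimately show ?case using ys(3) by metis
qed

section \<open>Block lists and set partitions\<close>

definition block_lists_on :: "nat set \<Rightarrow> (nat \<times> nat list) list set" where
  "block_lists_on X = {bs. block_list bs \<and> distinct (flat bs) \<and> set (flat bs) = X}"

text \<open>The first tail is recovered as the longest run of entries below the first head, since
  the next head is larger.\<close>

lemma flat_inj:
  assumes "block_list bs" and "block_list bs'" and "flat bs = flat bs'"
  shows "bs = bs'"
  using assms
proof (induction bs arbitrary: bs')
  case Nil
  then show ?case by (cases bs') auto
next
  case (Cons b bs)
  obtain c A where b: "b = (c, A)" by force
  obtain A' cs where bs': "bs' = (c, A') # cs" using Cons.prems(3) by (cases bs') (auto simp: b)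
  have A: "takeWhile (\<lambda>x. x < c) (B @ flat ds) = B" if "block_list ((c, B) # ds)" for B ds
  proof -
    have "takeWhile (\<lambda>x. x < c) (flat ds) = []"
      using that by (cases ds) (auto simp: block_list_Cons)
    then show ?thesis using that by (simp add: block_list_Cons takeWhile_append)
  qed
  have eq: "A @ flat bs = A' @ flat cs" using Cons.prems(3) by (simp add: b bs')
  then have "A = A'" using A[of A bs] A[of A' cs] Cons.prems b bs' by simp
  then show ?case using Cons eq by (simp add: b bs' block_list_Cons)
qed

definition block_set :: "nat \<times> nat list \<Rightarrow> nat set" where
  "block_set b = insert (fst b) (set (snd b))"

text \<open>Inverse to \<open>block_set\<close>: the head of a block is its maximum and the tail is
  increasing, so the underlying set determines the block.\<close>

definition set_block :: "nat set \<Rightarrow> nat \<times> nat list" where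
  "set_block B = (Max B, sorted_list_of_set (B - {Max B}))"

lemma set_block_block_set:
  assumes "sorted_wrt (<) (snd b)" and "\<forall>a \<in> set (snd b). a < fst b"
  shows "set_block (block_set b) = b"
proof -
  have "Max (block_set b) = fst b"
    unfolding block_set_def using assms(2) by (intro Max_eqI) (auto intro: less_imp_le)
  moreover have "block_set b - {fst b} = set (snd b)"
    unfolding block_set_def using assms(2) by auto
  ultimately show ?thesis
    using assms(1) by (simp add: set_block_def strict_sorted_iff
        sorted_list_of_set.idem_if_sorted_distinct)
qed

lemma block_set_set_block: "finite B \<Longrightarrow> B \<noteq> {} \<Longrightarrow> block_set (set_block B) = B"
  by (simp add: block_set_def set_block_def insert_absorb)

text \<open>No block repeats an entry, as its tail is increasing and below its head. Strictly
  increasing heads also exclude repeated blocks, so comparing the members of \<open>set bs\<close>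
  suffices.\<close>

lemma distinct_flat_iff:
  assumes "block_list bs"
  shows "distinct (flat bs) \<longleftrightarrow> (\<forall>b \<in> set bs. \<forall>b' \<in> set bs. b \<noteq> b' \<longrightarrow> block_set b \<inter> block_set b' = {})"
  using assms
proof (induction bs)
  case (Cons b bs)
  obtain c A where b: "b = (c, A)" by force
  have bl: "block_list bs" "sorted_wrt (<) A" "\<forall>a \<in> set A. a < c" "\<forall>x \<in> set bs. c < fst x"
    using Cons.prems by (auto simp: b block_list_Cons)
  have "b \<notin> set bs" using bl(4) b by auto
  have "distinct (flat (b # bs)) \<longleftrightarrow> block_set b \<inter> set (flat bs) = {} \<and> distinct (flat bs)"
    using bl by (auto simp: b block_set_def strict_sorted_iff)
  also have "set (flat bs) = (\<Union>b' \<in> set bs. block_set b')"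
    by (auto simp: set_flat block_set_def)
  also have "block_set b \<inter> \<dots> = {} \<longleftrightarrow> (\<forall>b' \<in> set bs. block_set b \<inter> block_set b' = {})" by blast
  finally have iff: "distinct (flat (b # bs)) \<longleftrightarrow> (\<forall>b' \<in> set bs. block_set b \<inter> block_set b' = {})
      \<and> (\<forall>d \<in> set bs. \<forall>d' \<in> set bs. d \<noteq> d' \<longrightarrow> block_set d \<inter> block_set d' = {})"
    unfolding Cons.IH[OF bl(1)] .
  define D where "D d d' \<longleftrightarrow> block_set d \<inter> block_set d' = {}" for d d'
  have "D d d' = D d' d" for d d' by (auto simp: D_def)
  then show ?case unfolding iff D_def[symmetric] using \<open>b \<notin> set bs\<close> by (metis set_ConsD list.set_intros)
qed simp

text \<open>The partition determines the set of pairs through \<open>set_block\<close>, and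
  increasing heads fix their order. Conversely, the parts of a partition are sorted by their
  maxima.\<close>

lemma bij_betw_block_lists_partitions:
  assumes "finite X"
  shows "bij_betw (\<lambda>bs. block_set ` set bs) (block_lists_on X) {P. partition_on X P}"
  unfolding bij_betw_def
proof
  show "inj_on (\<lambda>bs. block_set ` set bs) (block_lists_on X)"
  proof (rule inj_onI)
    fix bs bs'
    assume bs: "bs \<in> block_lists_on X" "bs' \<in> block_lists_on X"
      and eq: "block_set ` set bs = block_set ` set bs'"
    have recover: "set_block ` block_set ` set ds = set ds" if "ds \<in> block_lists_on X" for ds
    proof -
      have "set_block (block_set d) = d" if "d \<in> set ds" for d
        using that \<open>ds \<in> block_lists_on X\<close>
        by (intro set_block_block_set) (auto simp: block_lists_on_def block_list_def)
      then show ?thesis by (simp add: image_image)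
    qed
    have "set bs = set bs'" using recover[OF bs(1)] recover[OF bs(2)] eq by metis
    moreover have "sorted (map fst bs)" "distinct (map fst bs)"
      "sorted (map fst bs')" "distinct (map fst bs')"
      using bs by (auto simp: block_lists_on_def block_list_def strict_sorted_iff)
    moreover have "inj_on fst (set bs \<union> set bs')"
      using calculation by (simp add: distinct_map)
    ultimately show "bs = bs'" by (intro map_sorted_distinct_set_unique[of fst])
  qed
next
  show "(\<lambda>bs. block_set ` set bs) ` block_lists_on X = {P. partition_on X P}"
  proof (intro equalityI subsetI)
    fix P
    assume "P \<in> (\<lambda>bs. block_set ` set bs) ` block_lists_on X"
    then obtain bs where P: "P = block_set ` set bs" and bs: "bs \<in> block_lists_on X" by blast
    have "\<Union>P = X" using bs by (auto simp: P block_lists_on_def set_flat block_set_def)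
    moreover have "disjoint P"
    proof (rule disjointI)
      fix B B'
      assume "B \<in> P" "B' \<in> P" "B \<noteq> B'"
      then obtain b b' where b: "b \<in> set bs" "b' \<in> set bs" "B = block_set b" "B' = block_set b'" "b \<noteq> b'"
        unfolding P by blast
      moreover have "block_list bs" "distinct (flat bs)" using bs by (auto simp: block_lists_on_def)
      ultimately show "B \<inter> B' = {}" using distinct_flat_iff[of bs] by simp
    qed
    moreover have "{} \<notin> P" by (auto simp: P block_set_def)
    ultimately show "P \<in> {P. partition_on X P}" by (auto simp: partition_on_def)
  next
    fix P
    assume "P \<in> {P. partition_on X P}"
    then have P: "partition_on X P" by simp
    have fin: "finite P" using finite_elements[OF assms P] .
    have finB: "finite B" "B \<noteq> {}" if "B \<in> P" for B
      using that P assms by (auto simp: partition_on_def dest: finite_subset[OF Sup_upper])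
    obtain ds where ds: "set ds = set_block ` P" "distinct ds"
      using finite_distinct_list[of "set_block ` P"] fin by auto
    define bs where "bs = sort_key fst ds"
    have set_bs: "set bs = set_block ` P" by (simp add: bs_def ds)
    \<comment> \<open>Disjoint parts have different maxima, so sorting by heads gives a strictly
      increasing sequence.\<close>
    have inj: "inj_on fst (set_block ` P)"
    proof (rule inj_onI)
      fix b b'
      assume "b \<in> set_block ` P" "b' \<in> set_block ` P" and eq: "fst b = fst b'"
      then obtain B B' where B: "B \<in> P" "B' \<in> P" "b = set_block B" "b' = set_block B'" by blast
      have "Max B \<in> B" "Max B' \<in> B'" using finB Max_in B(1,2) by blast+
      moreover have "Max B = Max B'" using eq B(3,4) by (simp add: set_block_def)
      ultimately have "B \<inter> B' \<noteq> {}" by auto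
      then have "B = B'" using B(1,2) P by (auto simp: partition_on_def disjoint_def)
      then show "b = b'" using B by simp
    qed
    have bl: "block_list bs"
      unfolding block_list_def strict_sorted_iff
    proof (intro conjI ballI)
      show "sorted (map fst bs)" by (simp add: bs_def)
      show "distinct (map fst bs)"
        using inj ds by (simp add: distinct_map set_bs) (simp add: bs_def)
      fix b
      assume "b \<in> set bs"
      then obtain B where "B \<in> P" "b = set_block B" by (auto simp: set_bs)
      then show "case b of (c, A) \<Rightarrow> (sorted A \<and> distinct A) \<and> (\<forall>a \<in> set A. a < c)"
        using finB[of B] by (auto simp: set_block_def order_less_le)
    qed
    have blocks: "block_set ` set bs = P"
      using finB by (auto simp: set_bs image_image block_set_set_block)
    have "distinct (flat bs)"
      unfolding distinct_flat_iff[OF bl]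
    proof (intro ballI impI)
      fix b b'
      assume "b \<in> set bs" "b' \<in> set bs" "b \<noteq> b'"
      then obtain B B' where B: "B \<in> P" "B' \<in> P" "b = set_block B" "b' = set_block B'" "B \<noteq> B'"
        by (auto simp: set_bs)
      then show "block_set b \<inter> block_set b' = {}"
        using P finB by (auto simp: block_set_set_block partition_on_def disjoint_def)
    qed
    moreover have "set (flat bs) = \<Union>P"
      unfolding blocks[symmetric] by (auto simp: set_flat block_set_def)
    then have "set (flat bs) = X" using P by (simp add: partition_on_def)
    ultimately have "bs \<in> block_lists_on X" using bl by (simp add: block_lists_on_def)
    then show "P \<in> (\<lambda>bs. block_set ` set bs) ` block_lists_on X" using blocks by blast
  qed
qed

lemma block_list_append_tail:
  assumes "block_list bs" and "set (flat bs) = {1..m}"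
  shows "block_list (bs @ map (\<lambda>c. (c, [])) [Suc m..<Suc n])"
proof -
  have "fst b \<le> m" if "b \<in> set bs" for b
  proof -
    have "fst b \<in> set (flat bs)" using that unfolding set_flat by (intro UN_I[of b]) (auto split: prod.split)
    then show ?thesis using assms(2) by simp
  qed
  then show ?thesis
    using assms(1) block_list_singletons[of "[Suc m..<Suc n]"]
    by (force simp: block_list_append simp del: upt_Suc)
qed

lemma sorted_permutations_eq_flat_image:
  assumes "m \<le> n"
  shows "{p \<in> Sym n. n - m \<le> tail_length p \<and> tops_ok p} =
    (\<lambda>bs. flat bs @ [Suc m..<Suc n]) ` block_lists_on {1..m}" (is "?A = ?f ` _")
proof (intro equalityI subsetI)
  fix p
  assume "p \<in> ?A"
  then have p: "set p = {1..n}" "distinct p" "n - m \<le> tail_length p" "tops_ok p"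
    by (auto simp: Sym_def permutations_of_set_def)
  have len: "length p = n" using distinct_card[OF p(2)] p(1) by simp
  define q where "q = take m p"
  have "drop m p = [Suc m..<Suc n]" using tail_length_ge_iff[of "n - m" p] p(3) len assms by simp
  then have pq: "p = q @ [Suc m..<Suc n]" unfolding q_def by (metis append_take_drop_id)
  then have dq: "distinct q" "set q \<inter> {Suc m..<Suc n} = {}" using p(2) by auto
  have "set q \<union> {Suc m..<Suc n} = {1..n}" using p(1) unfolding pq by (simp del: upt_Suc)
  then have "set q = {1..n} - {Suc m..<Suc n}" using dq(2) by blast
  moreover have "{1..n} - {Suc m..<Suc n} = {1..m}" using assms by (intro set_eqI) (simp, linarith)
  ultimately have sq: "set q = {1..m}" by simp
  have "tops_ok q"
    unfolding tops_ok_def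
  proof (intro allI impI)
    fix L b a R
    assume "q = L @ b # a # R" "a < b"
    then show "\<forall>x \<in> set L. x < b"
      using p(4)[unfolded tops_ok_def, rule_format, of L b a "R @ [Suc m..<Suc n]"] pq by simp
  qed
  then obtain bs where "block_list bs" "flat bs = q" using tops_ok_imp_flat dq(1) by blast
  then show "p \<in> ?f ` block_lists_on {1..m}"
    using sq dq(1) pq by (auto simp: block_lists_on_def simp del: upt_Suc)
next
  fix p
  assume "p \<in> ?f ` block_lists_on {1..m}"
  then obtain bs where p: "p = flat bs @ [Suc m..<Suc n]"
    and bs: "block_list bs" "distinct (flat bs)" "set (flat bs) = {1..m}"
    by (auto simp: block_lists_on_def)
  have "{1..m} \<union> {Suc m..<Suc n} = {1..n}" using assms by (intro set_eqI) (simp, linarith)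
  then have sp: "set p = {1..n}" using bs by (simp add: p del: upt_Suc)
  have "{1..m} \<inter> {Suc m..<Suc n} = {}" by (rule Int_emptyI) simp
  then have dp: "distinct p" using bs by (simp add: p del: upt_Suc)
  have len: "length p = n" using distinct_card[OF dp] sp by simp
  have "length (flat bs) = m" using distinct_card[OF bs(2)] bs(3) by simp
  then have "n - m \<le> tail_length p"
    using tail_length_ge_iff[of "n - m" p] len assms by (simp add: p del: upt_Suc)
  \<comment> \<open>The tail is read as singleton blocks, which makes the whole word
    \<open>flat\<close> of a block list.\<close>
  moreover have "tops_ok p"
    using tops_ok_flat[OF block_list_append_tail[OF bs(1,3)], of n] by (simp add: p)
  ultimately show "p \<in> ?A" using sp dp by (simp add: Sym_def permutations_of_set_def)
qed

section \<open>The image of the iterate and its cardinality\<close>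

theorem theorem1p1:
  fixes m n :: nat
  assumes "m \<ge> 1" and "n \<ge> 1" and "n \<ge> 2 * m - 2"
  shows "(\<forall>\<pi> \<in> Sym n. \<pi> \<in> (stack_sort ^^ (n - m)) ` Sym n \<longleftrightarrow>
            tail_length \<pi> \<ge> n - m \<and> descent_tops \<pi> \<subseteq> left_to_right_maxima \<pi>)
       \<and> card ((stack_sort ^^ (n - m)) ` Sym n) = Bell m"
proof -
  \<comment> \<open>For \<open>m = 1\<close> this is \<open>n \<ge> 1\<close>; for larger
    \<open>m\<close> it follows from \<open>2 * m - 2 \<ge> m\<close>.\<close>
  have mn: "m \<le> n" using assms by linarith
  let ?I = "(stack_sort ^^ (n - m)) ` Sym n"
  let ?A = "{p \<in> Sym n. n - m \<le> tail_length p \<and> tops_ok p}"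
  let ?f = "\<lambda>bs. flat bs @ [Suc m..<Suc n]"
  have Sym: "p \<in> Sym n \<longleftrightarrow> distinct p \<and> set p = {1..n}" for p
    by (auto simp: Sym_def permutations_of_set_def)
  have "?I = ?A"
  proof (intro equalityI subsetI)
    fix p
    assume "p \<in> ?I"
    then obtain xs where xs: "distinct xs" "set xs = {1..n}" "p = (stack_sort ^^ (n - m)) xs"
      by (auto simp: Sym)
    have p: "distinct p" "set p = {1..n}"
      using xs by (auto simp: distinct_funpow_stack_sort set_funpow_stack_sort)
    have len: "length xs = n" "length p = n"
      using distinct_card[OF xs(1)] distinct_card[OF p(1)] xs(2) p(2) by auto
    obtain ys where ys: "p = ys @ [Suc m..<Suc n]" "distinct ys" "set ys = {1..m}"
      using funpow_stack_sort_tail[OF xs(1,2), of "n - m"] xs(3) mn by auto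
    have "length ys = m" using distinct_card[OF ys(2)] ys(3) by simp
    then have "n - m \<le> tail_length p"
      using tail_length_ge_iff[of "n - m" p] len mn by (simp add: ys(1) del: upt_Suc)
    moreover have "tops_ok p"
      \<comment> \<open>With \<open>t = n - m\<close>, the length bound
        \<open>n \<le> 2 * t + 2\<close> is precisely \<open>n \<ge> 2 * m - 2\<close>.\<close>
      unfolding xs(3) using xs(1) len assms by (intro tops_ok_funpow_stack_sort) auto
    ultimately show "p \<in> ?A" using p by (simp add: Sym)
  next
    fix p
    assume p: "p \<in> ?A"
    then have "p \<in> ?f ` block_lists_on {1..m}"
      by (simp only: sorted_permutations_eq_flat_image[OF mn])
    then obtain bs where bs: "p = ?f bs" "block_list bs" "set (flat bs) = {1..m}"
      by (auto simp: block_lists_on_def)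
    have "distinct p" using p by (simp add: Sym)
    then obtain xs where "mset xs = mset p" "(stack_sort ^^ (n - m)) xs = p"
      using flat_in_funpow_stack_sort_image[OF block_list_append_tail[OF bs(2,3)], of n] bs(1)
      by (auto simp del: upt_Suc)
    then show "p \<in> ?I"
      using p mset_eq_setD[of xs p] mset_eq_imp_distinct_iff[of xs p] by (force simp: Sym)
  qed
  moreover have "inj_on ?f (block_lists_on {1..m})"
    by (rule inj_onI) (auto simp: block_lists_on_def intro: flat_inj)
  then have "card ?A = card (block_lists_on {1..m})"
    unfolding sorted_permutations_eq_flat_image[OF mn] by (rule card_image)
  moreover have "card (block_lists_on {1..m}) = Bell m"
    unfolding Bell_def by (rule bij_betw_same_card[OF bij_betw_block_lists_partitions]) simp
  moreover have "descent_tops p \<subseteq> left_to_right_maxima p \<longleftrightarrow> tops_ok p" if "p \<in> Sym n" for p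
    using that by (intro descent_tops_subset_iff) (simp add: Sym)
  ultimately show ?thesis by auto
qed

end
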